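(* Let $(X_i)_{i\in\mathbb{N}}$ be i.i.d. random variables with values in $\mathbb{R}$ and distribution function $F(x)$, and define $$\hat F_n(x,\omega):=\frac1n\sum_{i=1}^n\mathbf{1}\{X_i(\omega)\leqslant x\},\quad \omega\in\Omega,\qquad\text{where}\quad \mathbb{E}[\hat F_n(x,\cdot)]=F(x)\quad\text{for all }x\in\mathbb{R},\ n\in\mathbb{N}.$$ Then $$\lim_{n\to\infty}\sup_{x\in\mathbb{R}}|\hat F_n(x,\cdot)-F(x)|=0\qquad\text{almost surely}$$ with exponential mean deviation frequency in the following sense: there is $K>0$ such that for any $\varepsilon>0$, $$\mathcal{O}_\varepsilon=\#\Big\{n\in\mathbb{N}~\Big|~\sup_{x\in\mathbb{R}}|\hat F_n(x,\cdot)-F(x)|\geqslant\varepsilon\Big\}$$ and $0<\eta<\varepsilon$ we have $$\mathbb{E}\big[e^{2\eta^2\mathcal{O}_\varepsilon}\big]\leqslant\frac{K}{\varepsilon^6(\varepsilon-\eta)},\qquad\text{and in particular}\qquad \mathbb{P}(\mathcal{O}_\varepsilon\geqslant k)\leqslant\frac{K}{\varepsilon^6(\varepsilon-\eta)}\cdot\exp(-2\varepsilon^2k)\quad\text{for all }k\in\mathbb{N}.$$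
   Context: $\mathbb{N}=\{1,2,\dots\}$. $(\Omega,\mathcal{A},\mathbb{P})$ is the underlying probability space, and $\mathbb{E}$ is the expectation with respect to $\mathbb{P}$.
   Formalization: The exponential moment bound is stated with a K that works for all 0<η<ε≤B, for each given B>0, because no single K can work as ε→∞ (there O_ε=0 and the expectation is 1 while the right side tends to 0); the tail bound is still for all ε>0. *)

theory Defs
  imports "HOL-Probability.Probability" "HOL-Library.Extended_Nat"
begin

definition emp_cdf :: "(nat \<Rightarrow> 'a \<Rightarrow> real) \<Rightarrow> nat \<Rightarrow> real \<Rightarrow> 'a \<Rightarrow> real" where
  "emp_cdf X n x \<omega> = (1 / real n) * (\<Sum>i=1..n. of_bool (X i \<omega> \<le> x))"

text \<open>For \<open>n \<ge> 1\<close> and a distribution function \<open>F\<close> the family below is bounded by 1,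
  so the real-valued supremum is a genuine one.\<close>

definition sup_dev :: "(nat \<Rightarrow> 'a \<Rightarrow> real) \<Rightarrow> (real \<Rightarrow> real) \<Rightarrow> nat \<Rightarrow> 'a \<Rightarrow> real" where
  "sup_dev X F n \<omega> = (SUP x. \<bar>emp_cdf X n x \<omega> - F x\<bar>)"

text \<open>The number of deviations may be infinite on a null set; a plain \<open>card\<close> would be 0 there.\<close>

definition dev_count :: "(nat \<Rightarrow> 'a \<Rightarrow> real) \<Rightarrow> (real \<Rightarrow> real) \<Rightarrow> real \<Rightarrow> 'a \<Rightarrow> enat" where
  "dev_count X F \<epsilon> \<omega> =
     (if finite {n. 1 \<le> n \<and> sup_dev X F n \<omega> \<ge> \<epsilon>}
      then enat (card {n. 1 \<le> n \<and> sup_dev X F n \<omega> \<ge> \<epsilon>}) else \<infinity>)"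

text \<open>\<open>exp_enat c N\<close> is \<open>exp (c * N)\<close> for \<open>c > 0\<close>, with value \<open>\<infinity>\<close> at \<open>N = \<infinity>\<close>.\<close>

definition exp_enat :: "real \<Rightarrow> enat \<Rightarrow> ennreal" where
  "exp_enat c N = (case N of enat m \<Rightarrow> ennreal (exp (c * real m)) | \<infinity> \<Rightarrow> \<infinity>)"

end

theory Submission
  imports Defs
begin

text \<open>
  Write \<open>D\<^sub>n = sup_dev X F n\<close>. Everything follows from one tail bound that is uniform in \<open>n\<close>: for
  \<open>0 < \<epsilon> \<le> 1\<close>, the event \<open>D\<^sub>n \<ge> \<epsilon>\<close> is contained in a measurable event of probability at most
  \<open>c / \<epsilon>\<^sup>4 exp (-2 n \<epsilon>\<^sup>2)\<close> with an absolute constant \<open>c\<close> (\<open>sup_dev_tail\<close>).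
  The Dvoretzky--Kiefer--Wolfowitz inequality gives the same without the factor \<open>1 / \<epsilon>\<^sup>4\<close>, but its proof is
  delicate, whereas the weaker bound needs only a union bound. This works for the following reason.

  Replacing the supremum over all \<open>x\<close> by a maximum over the \<open>n\<close>-quantiles of \<open>F\<close> costs only \<open>1/n\<close> in the
  deviation, hence a bounded factor \<open>exp (4 \<epsilon>)\<close> in the probability, but the union bound over these
  quantiles brings in a factor proportional to \<open>n\<close>. Hoeffding's inequality for a single point leaves that factor
  in place, which would spoil the exact rate \<open>exp (-2 k \<epsilon>\<^sup>2)\<close>. However, Hoeffding's exponent
  \<open>2 n \<epsilon>\<^sup>2\<close> is never attained for indicator variables: the variance \<open>t (1 - t)\<close> equals \<open>1/4\<close> only at
  \<open>t = 1/2\<close>, and the tilting parameter of Chernoff's method has to travel across an interval of length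
  \<open>\<epsilon>\<close>. The relative entropy of two Bernoulli laws at distance \<open>\<epsilon>\<close> is therefore at least
  \<open>2 \<epsilon>\<^sup>2 + \<epsilon>\<^sup>4 / 3\<close> (\<open>bernoulli_KL_ge\<close>), and the additional factor \<open>exp (-n \<epsilon>\<^sup>4 / 3)\<close> absorbs the
  \<open>n\<close> points of the union bound at the price of \<open>1 / \<epsilon>\<^sup>4\<close>.

  Given the tail bound, let \<open>N\<close> be the number of deviations of size \<open>\<epsilon>\<close>.
  If at least \<open>k\<close> deviations occur then one occurs at some \<open>n \<ge> k\<close>, so a
  geometric series gives \<open>P(N \<ge> k) \<le> c' / \<epsilon>\<^sup>6 exp (-2 \<epsilon>\<^sup>2 k)\<close>. Likewise \<open>exp (2 \<eta>\<^sup>2 N)\<close> is at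
  most \<open>1\<close> plus the sum of \<open>exp (2 \<eta>\<^sup>2 n)\<close> over all deviation times \<open>n\<close>, whose expectation is again a
  geometric series, now with ratio \<open>exp (-2 (\<epsilon>\<^sup>2 - \<eta>\<^sup>2))\<close>. Almost sure convergence is the Borel--Cantelli
  lemma. For \<open>\<epsilon> > 1\<close> there are no deviations at all.
\<close>

section \<open>Relative entropy of Bernoulli laws\<close>

definition bernoulli_KL :: "real \<Rightarrow> real \<Rightarrow> real" where
  "bernoulli_KL s r = s * ln (s / r) + (1 - s) * ln ((1 - s) / (1 - r))"

text \<open>
  The derivative of the logit is \<open>1 / (t (1 - t))\<close>. With \<open>u = t - 1/2\<close> this is
  \<open>4 / (1 - 4 u\<^sup>2) \<ge> 4 + 16 u\<^sup>2\<close>, and the integral of \<open>16 u\<^sup>2\<close> over an interval of given length is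
  smallest when the interval is centred at \<open>1/2\<close>. The cubic term comes from this second-order part.
\<close>

lemma logit_increment_ge:
  fixes a b :: real
  assumes "0 < a" "a \<le> b" "b < 1"
  shows "4 * (b - a) + 4/3 * (b - a) ^ 3 \<le> (ln b - ln (1 - b)) - (ln a - ln (1 - a))"
proof -
  define h where "h t = ln t - ln (1 - t) - 4 * t - 16/3 * (t - 1/2) ^ 3" for t :: real
  have "h a \<le> h b"
  proof (rule DERIV_nonneg_imp_nondecreasing[OF assms(2)])
    fix t assume t: "a \<le> t" "t \<le> b"
    with assms have t01: "0 < t" "t < 1" by auto
    have "(h has_real_derivative (1 / t + 1 / (1 - t) - 4 - 16 * (t - 1/2) ^ 2)) (at t)"
      unfolding h_def using t01
      by (auto intro!: derivative_eq_intros simp: field_simps power2_eq_square)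
    moreover have "1 / t + 1 / (1 - t) - 4 - 16 * (t - 1/2) ^ 2 = 16 * (t - 1/2) ^ 4 * 4 / (4 * t * (1 - t))"
      using t01 by (simp add: divide_simps) (simp add: algebra_simps power2_eq_square power4_eq_xxxx)
    moreover have "0 \<le> 16 * (t - 1/2) ^ 4 * 4 / (4 * t * (1 - t))"
      using t01 by simp
    ultimately show "\<exists>y. (h has_real_derivative y) (at t) \<and> 0 \<le> y" by metis
  qed
  moreover have "(b - a) ^ 3 \<le> 4 * ((b - 1/2) ^ 3 - (a - 1/2) ^ 3)"
  proof -
    have "4 * ((b - 1/2) ^ 3 - (a - 1/2) ^ 3) - (b - a) ^ 3 = 3 * (b - a) * (a + b - 1) ^ 2"
      by (simp add: power2_eq_square power3_eq_cube algebra_simps)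
    moreover have "0 \<le> 3 * (b - a) * (a + b - 1) ^ 2" using assms by simp
    ultimately show ?thesis by linarith
  qed
  ultimately show ?thesis unfolding h_def by (simp add: algebra_simps)
qed

text \<open>
  Pinsker's inequality with a fourth-order gain. The derivative of the relative entropy in its first
  argument is a difference of logits, so the bound is the previous lemma integrated from \<open>r\<close> to \<open>s\<close>.
\<close>

lemma bernoulli_KL_ge:
  fixes r s :: real
  assumes "0 < r" "r \<le> s" "s < 1"
  shows "2 * (s - r) ^ 2 + (s - r) ^ 4 / 3 \<le> bernoulli_KL s r"
proof -
  define f where "f t = t * (ln t - ln r) + (1 - t) * (ln (1 - t) - ln (1 - r))
     - 2 * (t - r) ^ 2 - (t - r) ^ 4 / 3" for t :: real
  have "f r \<le> f s"
  proof (rule DERIV_nonneg_imp_nondecreasing[OF assms(2)])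
    fix t assume t: "r \<le> t" "t \<le> s"
    with assms have t01: "0 < t" "t < 1" by auto
    have "((\<lambda>t. t * (ln t - ln r)) has_real_derivative (ln t - ln r + 1)) (at t)"
      using t01 by (auto intro!: derivative_eq_intros)
    moreover have "((\<lambda>t. (1 - t) * (ln (1 - t) - ln (1 - r))) has_real_derivative
        - (ln (1 - t) - ln (1 - r) + 1)) (at t)"
      using t01 by (auto intro!: derivative_eq_intros)
    moreover have "((\<lambda>t. 2 * (t - r)\<^sup>2) has_real_derivative 4 * (t - r)) (at t)"
      by (auto intro!: derivative_eq_intros)
    moreover have "((\<lambda>t. (t - r) ^ 4 / 3) has_real_derivative 4/3 * (t - r) ^ 3) (at t)"
      by (auto intro!: derivative_eq_intros)
    ultimately have "(f has_real_derivative (ln t - ln r + 1) + - (ln (1 - t) - ln (1 - r) + 1)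
        - 4 * (t - r) - 4/3 * (t - r) ^ 3) (at t)"
      unfolding f_def by (intro DERIV_diff DERIV_add)
    then have "(f has_real_derivative ((ln t - ln (1 - t)) - (ln r - ln (1 - r))
        - (4 * (t - r) + 4/3 * (t - r) ^ 3))) (at t)"
      by (simp add: algebra_simps)
    moreover have "0 \<le> (ln t - ln (1 - t)) - (ln r - ln (1 - r)) - (4 * (t - r) + 4/3 * (t - r) ^ 3)"
      using logit_increment_ge[of r t] assms t by auto
    ultimately show "\<exists>y. (f has_real_derivative y) (at t) \<and> 0 \<le> y" by blast
  qed
  then show ?thesis
    using assms by (simp add: f_def bernoulli_KL_def ln_div)
qed

section \<open>Sharpened Hoeffding bound for empirical frequencies\<close>

locale iid_real_sequence = prob_space M
  for M :: "'a measure" +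
  fixes X :: "nat \<Rightarrow> 'a \<Rightarrow> real" and D :: "real measure"
  assumes indep: "indep_vars (\<lambda>_. borel) X {1..}"
    and identically_distributed: "\<And>i. 1 \<le> i \<Longrightarrow> distr M borel (X i) = D"
begin

lemma random_variable_X [measurable]: "1 \<le> i \<Longrightarrow> X i \<in> borel_measurable M"
  using indep by (auto simp: indep_vars_def)

lemma real_distribution_D: "real_distribution D"
  using identically_distributed[of 1] real_distribution_distr[of "X 1"] random_variable_X[of 1] by auto

sublocale D: cdf_distribution D
  unfolding cdf_distribution_def by (rule real_distribution_D)

definition freq :: "nat \<Rightarrow> real set \<Rightarrow> 'a \<Rightarrow> real" where
  "freq n A \<omega> = (\<Sum>i=1..n. indicator A (X i \<omega>)) / real n"

lemma freq_measurable [measurable]: "A \<in> sets borel \<Longrightarrow> freq n A \<in> borel_measurable M"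
  unfolding freq_def by (intro borel_measurable_divide borel_measurable_sum borel_measurable_const
    measurable_compose[OF random_variable_X borel_measurable_indicator]) auto

lemma emp_cdf_eq_freq: "emp_cdf X n x \<omega> = freq n {..x} \<omega>"
  by (simp add: emp_cdf_def freq_def indicator_def of_bool_def)

lemma freq_mono: "A \<subseteq> B \<Longrightarrow> freq n A \<omega> \<le> freq n B \<omega>"
  unfolding freq_def by (intro divide_right_mono sum_mono) (auto simp: indicator_def)

lemma freq_nonneg: "0 \<le> freq n A \<omega>"
  unfolding freq_def by (intro divide_nonneg_nonneg sum_nonneg) auto

lemma freq_UNIV: "1 \<le> n \<Longrightarrow> freq n UNIV \<omega> = 1"
  by (simp add: freq_def)

lemma freq_le_1: "freq n A \<omega> \<le> 1"
proof (cases "n = 0")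
  case False
  then show ?thesis using freq_mono[of A UNIV n \<omega>] freq_UNIV[of n \<omega>] by auto
qed (simp add: freq_def)

lemma freq_Compl: "1 \<le> n \<Longrightarrow> freq n (- A) \<omega> = 1 - freq n A \<omega>"
  by (simp add: freq_def indicator_compl sum_subtractf diff_divide_distrib)

lemma expectation_indicator_X:
  assumes "1 \<le> i" "A \<in> sets borel"
  shows "expectation (\<lambda>\<omega>. indicator A (X i \<omega>)) = measure D A"
proof -
  have "measure D A = (\<integral>x. indicator A x \<partial>D)"
    using assms by simp
  also have "\<dots> = expectation (\<lambda>\<omega>. indicator A (X i \<omega>))"
    using assms by (subst identically_distributed[OF assms(1), symmetric], subst integral_distr) auto
  finally show ?thesis by simp
qed

lemma integrable_indicator_X:
  assumes "1 \<le> i" "A \<in> sets borel"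
  shows "integrable M (\<lambda>\<omega>. indicat_real A (X i \<omega>))"
  using assms by (intro integrable_const_bound[where B = 1]) auto

lemma expectation_freq:
  assumes "1 \<le> n" "A \<in> sets borel"
  shows "integrable M (freq n A)" "expectation (freq n A) = measure D A"
  unfolding freq_def using assms
  by (auto simp: integrable_indicator_X expectation_indicator_X Bochner_Integration.integral_sum
       intro!: Bochner_Integration.integrable_sum)

text \<open>
  Chernoff's method for the event that \<open>X i\<close> hits \<open>A\<close>. The bound is stated for any \<open>r\<close> above the true
  probability of \<open>A\<close>, because the relative entropy is well behaved only for \<open>0 < r\<close> and \<open>s < 1\<close>; the slack
  lets a limit reach the boundary cases.
\<close>

lemma freq_Chernoff_KL:
  assumes A: "A \<in> sets borel" and n: "1 \<le> n"
    and r: "measure D A \<le> r" "0 < r" "r \<le> s" "s < 1"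
  shows "prob {\<omega> \<in> space M. s \<le> freq n A \<omega>} \<le> exp (- real n * bernoulli_KL s r)"
proof -
  \<comment> \<open>\<open>w\<close> is the exponential of the optimal tilting parameter: under the tilted law a Bernoulli
    variable of mean \<open>r\<close> has mean \<open>s\<close>.\<close>
  define w where "w = s * (1 - r) / (r * (1 - s))"
  have w: "1 \<le> w" unfolding w_def using r by (auto simp: field_simps)
  define Y where "Y i \<omega> = 1 + (w - 1) * indicator A (X i \<omega>)" for i \<omega>
  have Y_powr: "Y i \<omega> = w powr indicator A (X i \<omega>)" for i \<omega>
    using w by (auto simp: Y_def indicator_def)
  have Y_int: "integrable M (Y i)" if "1 \<le> i" for i
    unfolding Y_def using integrable_indicator_X[OF that A] by auto
  have Y_E: "expectation (Y i) = 1 + (w - 1) * measure D A" if "1 \<le> i" for i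
    unfolding Y_def using integrable_indicator_X[OF that A] expectation_indicator_X[OF that A]
    by (simp add: prob_space)
  have Y_indep: "indep_vars (\<lambda>_. borel) Y {1..n}"
  proof -
    have "indep_vars (\<lambda>_. borel) (\<lambda>i \<omega>. 1 + (w - 1) * indicator A (X i \<omega>)) {1..n}"
      by (rule indep_vars_compose2[where M' = "\<lambda>_. borel" and Y = "\<lambda>i x. 1 + (w - 1) * indicator A x"])
         (use A in \<open>auto intro!: indep_vars_subset[OF indep]\<close>)
    then show ?thesis by (simp add: Y_def[abs_def])
  qed
  have prod_eq: "(\<Prod>i\<in>{1..n}. Y i \<omega>) = w powr (real n * freq n A \<omega>)" for \<omega>
    using w n by (simp add: Y_powr powr_sum freq_def)
  have prod_nonneg': "0 \<le> (\<Prod>i\<in>{Suc 0..n}. Y i \<omega>)" for \<omega>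
    using prod_eq[of \<omega>] by simp
  have "prob {\<omega> \<in> space M. s \<le> freq n A \<omega>} \<le> prob {\<omega> \<in> space M. w powr (real n * s) \<le> (\<Prod>i\<in>{1..n}. Y i \<omega>)}"
  proof (rule finite_measure_mono)
    show "{\<omega> \<in> space M. w powr (real n * s) \<le> (\<Prod>i\<in>{1..n}. Y i \<omega>)} \<in> events"
      unfolding prod_eq using A by measurable
  qed (use w in \<open>auto simp only: prod_eq intro!: powr_mono mult_left_mono\<close>)
  also have "\<dots> \<le> expectation (\<lambda>\<omega>. \<Prod>i\<in>{1..n}. Y i \<omega>) / w powr (real n * s)"
    using w Y_int Y_indep
    by (intro integral_Markov_inequality_measure[where A = "{}"] indep_vars_integrable)
       (auto simp: prod_nonneg')
  also have "expectation (\<lambda>\<omega>. \<Prod>i\<in>{1..n}. Y i \<omega>) = (1 + (w - 1) * measure D A) ^ n"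
    using Y_int Y_indep by (subst indep_vars_lebesgue_integral) (auto simp: Y_E)
  also have "(1 + (w - 1) * measure D A) ^ n \<le> (1 + (w - 1) * r) ^ n"
    using w r by (intro power_mono add_left_mono mult_left_mono) auto
  also have "1 + (w - 1) * r = (1 - r) / (1 - s)"
    using r by (simp add: w_def divide_simps) (simp add: algebra_simps)
  also have "((1 - r) / (1 - s)) ^ n / w powr (real n * s) = exp (- real n * bernoulli_KL s r)"
  proof -
    have "((1 - r) / (1 - s)) ^ n = exp (real n * (ln (1 - r) - ln (1 - s)))"
      using r by (simp add: exp_of_nat_mult exp_diff)
    moreover have "w powr (real n * s) = exp (real n * (s * (ln s + ln (1 - r) - ln r - ln (1 - s))))"
      using r w by (simp add: powr_def w_def ln_div ln_mult mult_ac)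
    ultimately show ?thesis
      using r by (simp add: exp_diff[symmetric] bernoulli_KL_def ln_div algebra_simps)
  qed
  finally show ?thesis
    using w by (simp add: divide_right_mono)
qed

text \<open>
  The boundary cases \<open>measure D A = 0\<close> and \<open>measure D A + e = 1\<close>, where the relative entropy
  involves \<open>ln 0\<close> or a division by \<open>0\<close>, are reached by moving both ends of the interval inwards by \<open>h\<close> and letting \<open>h\<close> tend to \<open>0\<close>.
\<close>

lemma freq_Hoeffding_sharpened:
  assumes A: "A \<in> sets borel" and n: "1 \<le> n" and e: "0 < e"
  shows "prob {\<omega> \<in> space M. measure D A + e \<le> freq n A \<omega>}
           \<le> exp (- real n * (2 * e\<^sup>2 + e ^ 4 / 3))"
proof (cases "measure D A + e \<le> 1")
  case False
  then have "freq n A \<omega> < measure D A + e" for \<omega>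
    using freq_le_1[of n A \<omega>] by simp
  then have "{\<omega> \<in> space M. measure D A + e \<le> freq n A \<omega>} = {}"
    by (auto simp: not_le)
  then show ?thesis by (simp only: measure_empty) simp
next
  case True
  define p where "p = measure D A"
  have p: "0 \<le> p" by (simp add: p_def)
  have small: "\<forall>\<^sub>F h in at_right 0. h \<in> {0<..<e / 2}"
    using e by (intro eventually_at_right_real) simp
  have "((\<lambda>h. exp (- real n * (2 * (e - 2 * h)\<^sup>2 + (e - 2 * h) ^ 4 / 3))) \<longlongrightarrow>
           exp (- real n * (2 * (e - 2 * 0)\<^sup>2 + (e - 2 * 0) ^ 4 / 3))) (at_right 0)"
    by (intro tendsto_intros) simp
  moreover have "\<forall>\<^sub>F h in at_right 0. prob {\<omega> \<in> space M. p + e \<le> freq n A \<omega>}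
       \<le> exp (- real n * (2 * (e - 2 * h)\<^sup>2 + (e - 2 * h) ^ 4 / 3))"
    using small
  proof eventually_elim
    case (elim h)
    then have h: "0 < h" "2 * h < e" using e by auto
    have "prob {\<omega> \<in> space M. p + e \<le> freq n A \<omega>} \<le> prob {\<omega> \<in> space M. p + e - h \<le> freq n A \<omega>}"
      using A h by (intro finite_measure_mono) auto
    also have "\<dots> \<le> exp (- real n * bernoulli_KL (p + e - h) (p + h))"
      using A n h p True by (intro freq_Chernoff_KL) (auto simp: p_def add_nonneg_pos)
    also have "\<dots> \<le> exp (- real n * (2 * (e - 2 * h)\<^sup>2 + (e - 2 * h) ^ 4 / 3))"
    proof -
      have "p + e - h - (p + h) = e - 2 * h" by simp
      then have "2 * (e - 2 * h)\<^sup>2 + (e - 2 * h) ^ 4 / 3 \<le> bernoulli_KL (p + e - h) (p + h)"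
        using bernoulli_KL_ge[of "p + h" "p + e - h"] h p True
        by (auto simp: p_def add_nonneg_pos)
      then show ?thesis by (simp add: mult_left_mono)
    qed
    finally show ?case .
  qed
  ultimately show ?thesis
    by (intro tendsto_lowerbound[where F = "at_right (0::real)"]) (auto simp: p_def)
qed

section \<open>Discretisation by quantiles\<close>

lemma quantile:
  assumes "0 < u" "u < 1"
  obtains q where "\<And>x. u \<le> cdf D x \<longleftrightarrow> q \<le> x" "measure D {..<q} \<le> u"
proof -
  define q where "q = D.I u"
  have q: "u \<le> cdf D x \<longleftrightarrow> q \<le> x" for x
    unfolding q_def by (rule D.pseudoinverse[OF assms])
  have "\<forall>\<^sub>F x in at_left q. cdf D x \<le> u"
  proof (rule eventually_at_leftI[of "q - 1"])
    fix x assume "x \<in> {q - 1<..<q}"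
    then have "\<not> u \<le> cdf D x" using q by simp
    then show "cdf D x \<le> u" by simp
  qed simp
  then have "measure D {..<q} \<le> u"
    by (intro tendsto_upperbound[OF D.cdf_at_left]) auto
  with q show ?thesis by (rule that)
qed

text \<open>
  Half-lines ending at the quantiles of order \<open>j / m\<close> sandwich every half-line \<open>{..x}\<close> up to mass
  \<open>1 / m\<close>. The upper bracket has to be an open half-line: if \<open>D\<close> has an atom at the quantile, the closed
  half-line may be much heavier than \<open>j / m\<close>.
\<close>

lemma finite_brackets:
  assumes m: "1 \<le> m"
  obtains \<A> where "finite \<A>" "card \<A> \<le> 2 * m" "\<A> \<subseteq> sets borel"
    "\<And>x. \<exists>A\<in>\<A>. \<exists>B\<in>\<A>. A \<subseteq> {..x} \<and> {..x} \<subseteq> B \<and> measure D B \<le> measure D A + 1 / real m"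
proof -
  have "\<forall>j\<in>{1..<m}. \<exists>q. (\<forall>x. real j / real m \<le> cdf D x \<longleftrightarrow> q \<le> x) \<and> measure D {..<q} \<le> real j / real m"
  proof
    fix j assume "j \<in> {1..<m}"
    then have "0 < real j / real m" "real j / real m < 1" by auto
    then show "\<exists>q. (\<forall>x. real j / real m \<le> cdf D x \<longleftrightarrow> q \<le> x) \<and> measure D {..<q} \<le> real j / real m"
      by (rule quantile) blast
  qed
  then obtain q where q: "\<And>j x. j \<in> {1..<m} \<Longrightarrow> real j / real m \<le> cdf D x \<longleftrightarrow> q j \<le> x"
    "\<And>j. j \<in> {1..<m} \<Longrightarrow> measure D {..<q j} \<le> real j / real m"
    by metis
  define \<A> where "\<A> = {{}, UNIV} \<union> ((\<lambda>j. {..q j}) ` {1..<m} \<union> (\<lambda>j. {..<q j}) ` {1..<m})"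
  show ?thesis
  proof (rule that[of \<A>])
    show "finite \<A>" by (simp add: \<A>_def)
    show "\<A> \<subseteq> sets borel" by (auto simp: \<A>_def)
    have "card \<A> \<le> card {{}, UNIV :: real set} + (card ((\<lambda>j. {..q j}) ` {1..<m}) + card ((\<lambda>j. {..<q j}) ` {1..<m}))"
      unfolding \<A>_def by (meson card_Un_le add_left_mono order_trans)
    also have "\<dots> \<le> 2 + ((m - 1) + (m - 1))"
      by (intro add_mono) (auto intro!: card_image_le[THEN order_trans] simp: card_insert_if)
    finally show "card \<A> \<le> 2 * m" using m by simp
  next
    fix x
    \<comment> \<open>The cap at \<open>m - 1\<close> matters when \<open>cdf D x = 1\<close>:
      a quantile of order \<open>1\<close> may fail to exist.\<close>
    define j where "j = min (m - 1) (nat \<lfloor>real m * cdf D x\<rfloor>)"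
    have F: "0 \<le> cdf D x" "cdf D x \<le> 1" by (auto simp: D.cdf_nonneg D.cdf_bounded_prob)
    have j: "j < m" using m by (auto simp: j_def)
    have "real j \<le> real (nat \<lfloor>real m * cdf D x\<rfloor>)" by (simp add: j_def)
    also have "\<dots> \<le> real m * cdf D x" using F by simp
    finally have "real j \<le> real m * cdf D x" .
    then have lower: "real j / real m \<le> cdf D x" using m by (simp add: field_simps)
    have upper: "cdf D x < (real j + 1) / real m" if "Suc j < m"
    proof -
      have "real m * cdf D x < real j + 1"
        using that F by (auto simp: j_def min_def split: if_splits; linarith)
      then show ?thesis using m by (simp add: field_simps)
    qed
    define A where "A = (if j = 0 then {} else {..q j})"
    define B where "B = (if Suc j < m then {..<q (Suc j)} else UNIV)"
    have "A \<in> \<A>" "B \<in> \<A>" using j by (auto simp: A_def B_def \<A>_def)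
    moreover have "A \<subseteq> {..x}" using q(1)[of j x] j lower by (auto simp: A_def)
    moreover have "{..x} \<subseteq> B" using q(1)[of "Suc j" x] upper by (auto simp: B_def add.commute)
    moreover have "real j / real m \<le> measure D A"
      using q(1)[of j "q j"] j by (auto simp: A_def cdf_def)
    moreover have "measure D B \<le> (real j + 1) / real m"
    proof (cases "Suc j < m")
      case True
      then show ?thesis using q(2)[of "Suc j"] by (simp add: B_def add.commute)
    next
      case False
      with j have "Suc j = m" by simp
      then have "(real j + 1) / real m = 1" using m by (metis add.commute divide_self_if le_zero_eq of_nat_Suc of_nat_eq_0_iff one_neq_zero)
      then show ?thesis by simp
    qed
    ultimately show "\<exists>A\<in>\<A>. \<exists>B\<in>\<A>. A \<subseteq> {..x} \<and> {..x} \<subseteq> B \<and> measure D B \<le> measure D A + 1 / real m"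
      by (intro bexI[of _ A] bexI[of _ B]) (auto simp: add_divide_distrib)
  qed
qed

text \<open>
  By monotonicity of \<open>freq\<close> and of \<open>D\<close>, the deviation at \<open>x\<close> is controlled by the deviations of two
  bracketing sets. Deviations below the mean are expressed as deviations of the complement above the
  mean, so that a one-sided tail bound suffices. The maximum over the finite family is what keeps the
  inequality strict after passing to the supremum over \<open>x\<close>.
\<close>

lemma sup_dev_less_if_brackets:
  assumes n: "1 \<le> n"
    and \<A>: "finite \<A>" "\<A> \<subseteq> sets borel"
    and brackets: "\<And>x. \<exists>A\<in>\<A>. \<exists>B\<in>\<A>. A \<subseteq> {..x} \<and> {..x} \<subseteq> B \<and> measure D B \<le> measure D A + d"
    and dev: "\<And>A. A \<in> \<A> \<Longrightarrow> freq n A \<omega> < measure D A + e"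
             "\<And>A. A \<in> \<A> \<Longrightarrow> freq n (- A) \<omega> < measure D (- A) + e"
  shows "sup_dev X (cdf D) n \<omega> < e + d"
proof -
  define g where "g A = \<bar>freq n A \<omega> - measure D A\<bar>" for A
  define G where "G = Max (g ` \<A>)"
  have "\<A> \<noteq> {}" using brackets by blast
  have D_Compl: "measure D (- A) = 1 - measure D A" if "A \<in> \<A>" for A
    using D.prob_compl[of A] that \<A> by (auto simp: Compl_eq_Diff_UNIV)
  have "g A < e" if "A \<in> \<A>" for A
    using dev[OF that] D_Compl[OF that] freq_Compl[OF n, of A \<omega>] unfolding g_def by linarith
  then have G: "G < e" unfolding G_def using \<A> \<open>\<A> \<noteq> {}\<close> by simp
  have g: "g A \<le> G" if "A \<in> \<A>" for A unfolding G_def using \<A> that by simp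
  have "\<bar>emp_cdf X n x \<omega> - cdf D x\<bar> \<le> G + d" for x
  proof -
    obtain A B where AB: "A \<in> \<A>" "B \<in> \<A>" "A \<subseteq> {..x}" "{..x} \<subseteq> B"
      "measure D B \<le> measure D A + d" using brackets by meson
    have "measure D A \<le> cdf D x" "cdf D x \<le> measure D B"
      unfolding cdf_def using AB \<A> by (auto intro!: D.finite_measure_mono)
    moreover have "freq n A \<omega> \<le> emp_cdf X n x \<omega>" "emp_cdf X n x \<omega> \<le> freq n B \<omega>"
      unfolding emp_cdf_eq_freq using AB by (auto intro!: freq_mono)
    ultimately show ?thesis
      using g[OF AB(1)] g[OF AB(2)] AB(5) unfolding g_def by linarith
  qed
  then have "sup_dev X (cdf D) n \<omega> \<le> G + d"
    unfolding sup_dev_def by (intro cSUP_least) auto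
  with G show ?thesis by linarith
qed

text \<open>
  The uniform tail bound. It is phrased through a covering event \<open>E\<close>, a finite union of events about
  \<open>freq\<close>, because this makes subadditivity and the Borel--Cantelli lemma applicable directly.
\<close>

lemma sup_dev_tail:
  assumes n: "1 \<le> n" and e: "0 < e" "e \<le> 1"
  obtains E where "E \<in> events" "{\<omega> \<in> space M. e \<le> sup_dev X (cdf D) n \<omega>} \<subseteq> E"
    "prob E \<le> 192 * exp 4 / e ^ 4 * exp (- 2 * real n * e\<^sup>2)"
proof (cases "real n * e \<le> 2")
  case True
  \<comment> \<open>The mesh \<open>1 / n\<close> is not small compared with \<open>e\<close>, but then the claimed bound exceeds \<open>1\<close>.\<close>
  have "1 \<le> exp (4 - 2 * real n * e\<^sup>2)"
    using mult_mono[OF True \<open>e \<le> 1\<close>] e by (simp add: power2_eq_square mult_ac)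
  also have "\<dots> = exp 4 * exp (- 2 * real n * e\<^sup>2)" by (simp flip: exp_add)
  also have "\<dots> \<le> 192 / e ^ 4 * (exp 4 * exp (- 2 * real n * e\<^sup>2))"
    using power_le_one[of e 4] e mult_right_mono[of 1 "192 / e ^ 4" "exp 4 * exp (- 2 * real n * e\<^sup>2)"]
    by (auto simp: field_simps)
  finally show ?thesis
    by (intro that[of "space M"]) (auto simp: prob_space)
next
  case False
  define d where "d = 1 / real n"
  have d: "0 < d" "d < e / 2" "real n * d = 1" using n False by (auto simp: d_def field_simps)
  obtain \<A> where \<A>: "finite \<A>" "card \<A> \<le> 2 * n" "\<A> \<subseteq> sets borel"
    and br: "\<And>x. \<exists>A\<in>\<A>. \<exists>B\<in>\<A>. A \<subseteq> {..x} \<and> {..x} \<subseteq> B \<and> measure D B \<le> measure D A + d"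
    using finite_brackets[OF n] unfolding d_def by metis
  define bad where "bad A = {\<omega> \<in> space M. measure D A + (e - d) \<le> freq n A \<omega>}" for A
  define p where "p = exp (- real n * (2 * (e - d)\<^sup>2 + (e - d) ^ 4 / 3))"
  have bad: "bad A \<in> events" "prob (bad A) \<le> p" if "A \<in> sets borel" for A
    using freq_Hoeffding_sharpened[OF that n, of "e - d"] d that unfolding bad_def p_def by auto
  have Compl: "- A \<in> sets borel" if "A \<in> \<A>" for A using \<A> that by (auto intro: borel_comp)
  define E where "E = (\<Union>A\<in>\<A>. bad A \<union> bad (- A))"
  have "E \<in> events" unfolding E_def using \<A> bad Compl by (intro sets.finite_UN) auto
  moreover have "{\<omega> \<in> space M. e \<le> sup_dev X (cdf D) n \<omega>} \<subseteq> E"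
  proof (rule ccontr)
    assume "\<not> ?thesis"
    then obtain \<omega> where \<omega>: "\<omega> \<in> space M" "e \<le> sup_dev X (cdf D) n \<omega>" "\<omega> \<notin> E" by auto
    then have "freq n A \<omega> < measure D A + (e - d)" "freq n (- A) \<omega> < measure D (- A) + (e - d)"
      if "A \<in> \<A>" for A
      using that by (auto simp: E_def bad_def not_le)
    then have "sup_dev X (cdf D) n \<omega> < (e - d) + d"
      using \<A> br n by (intro sup_dev_less_if_brackets[of n \<A>])
    with \<omega> show False by simp
  qed
  moreover have "prob E \<le> 192 * exp 4 / e ^ 4 * exp (- 2 * real n * e\<^sup>2)"
  proof -
    \<comment> \<open>Squaring \<open>e - d\<close> with \<open>d = 1 / n\<close> loses at most \<open>4 e \<le> 4\<close> in the exponent, and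
      \<open>e - d \<ge> e / 2\<close> keeps a sixteenth of the fourth-order gain.\<close>
    have p_le: "p \<le> exp (4 - 2 * real n * e\<^sup>2 - real n * e ^ 4 / 48)"
    proof -
      have "2 * real n * (e - d)\<^sup>2 = 2 * real n * e\<^sup>2 - 4 * e * (real n * d) + 2 * d * (real n * d)"
        by (simp add: power2_eq_square algebra_simps)
      then have "2 * real n * e\<^sup>2 - 4 \<le> 2 * real n * (e - d)\<^sup>2" using d e by simp
      moreover have "(e / 2) ^ 4 \<le> (e - d) ^ 4" using d e by (intro power_mono) auto
      then have "real n * e ^ 4 / 48 \<le> real n * ((e - d) ^ 4 / 3)"
        using mult_left_mono[of "(e / 2) ^ 4" "(e - d) ^ 4" "real n"] by (simp add: power_divide)
      ultimately show ?thesis by (simp add: p_def algebra_simps)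
    qed
    have "prob E \<le> (\<Sum>A\<in>\<A>. prob (bad A \<union> bad (- A)))"
      unfolding E_def using \<A> bad Compl by (intro measure_UNION_le) auto
    also have "\<dots> \<le> (\<Sum>A\<in>\<A>. 2 * p)"
    proof (rule sum_mono)
      fix A assume "A \<in> \<A>"
      then show "prob (bad A \<union> bad (- A)) \<le> 2 * p"
        using measure_Un_le[OF bad(1)[of A] bad(1)[of "- A"]] bad[of A] bad[OF Compl, of A] \<A> by auto
    qed
    also have "\<dots> = real (card \<A>) * (2 * p)" by simp
    also have "\<dots> \<le> (2 * real n) * (2 * p)"
      using \<A> by (intro mult_right_mono) (auto simp: p_def)
    also have "\<dots> \<le> 2 * real n * (2 * exp (4 - 2 * real n * e\<^sup>2 - real n * e ^ 4 / 48))"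
      by (intro mult_left_mono p_le) auto
    also have "\<dots> = (4 * real n * exp (- (real n * e ^ 4 / 48))) * (exp 4 * exp (- 2 * real n * e\<^sup>2))"
    proof -
      have "4 - 2 * real n * e\<^sup>2 - real n * e ^ 4 / 48
          = - (real n * e ^ 4 / 48) + (4 + (- 2 * real n * e\<^sup>2))" by simp
      then show ?thesis by (simp only: exp_add mult_ac)
    qed
    also have "\<dots> \<le> (192 / e ^ 4) * (exp 4 * exp (- 2 * real n * e\<^sup>2))"
    proof (rule mult_right_mono)
      \<comment> \<open>The at most \<open>4 n\<close> events in the union are absorbed by the fourth-order gain.\<close>
      have "real n * e ^ 4 / 48 \<le> exp (real n * e ^ 4 / 48)"
        using exp_ge_add_one_self[of "real n * e ^ 4 / 48"] by linarith
      then show "4 * real n * exp (- (real n * e ^ 4 / 48)) \<le> 192 / e ^ 4"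
        using e by (simp add: exp_minus field_simps)
    qed simp
    finally show ?thesis by (simp only: times_divide_eq_left mult.assoc)
  qed
  ultimately show ?thesis by (rule that)
qed

end

section \<open>Counting deviations along the sequence\<close>

lemma
  fixes c :: real
  assumes "0 < c"
  shows summable_exp_tail: "summable (\<lambda>n. exp (- c * real (n + k)))"
    and suminf_exp_tail_le: "(\<Sum>n. exp (- c * real (n + k))) \<le> (1 + 1 / c) * exp (- c * real k)"
    and suminf_exp_from_1_le: "(\<Sum>n. exp (- c * real (n + 1))) \<le> 1 / c"
proof -
  have q: "norm (exp (- c)) < 1" using assms by simp
  have eq: "exp (- c * real (n + k)) = exp (- c * real k) * exp (- c) ^ n" for n k
    by (simp add: exp_of_nat_mult[symmetric] exp_add[symmetric] algebra_simps)
  have sums: "(\<lambda>n. exp (- c * real (n + k))) sums (exp (- c * real k) * (1 / (1 - exp (- c))))" for k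
    unfolding eq by (intro sums_mult geometric_sums q)
  then show "summable (\<lambda>n. exp (- c * real (n + k)))" by (rule sums_summable)
  have "1 + c \<le> exp c" by (rule exp_ge_add_one_self)
  then have g: "1 / (1 - exp (- c)) \<le> 1 + 1 / c" "exp (- c) * (1 / (1 - exp (- c))) \<le> 1 / c"
    using assms by (auto simp: exp_minus divide_simps) (auto simp: algebra_simps)
  show "(\<Sum>n. exp (- c * real (n + k))) \<le> (1 + 1 / c) * exp (- c * real k)"
    using mult_right_mono[OF g(1), of "exp (- c * real k)"]
    by (subst sums_unique[OF sums, symmetric]) (simp add: mult.commute)
  show "(\<Sum>n. exp (- c * real (n + 1))) \<le> 1 / c"
    using g(2) by (subst sums_unique[OF sums, symmetric]) simp
qed

text \<open>
  The largest deviation time is at least the number of deviations, so its summand alone dominates the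
  left-hand side. Infinitely many deviation times make the series diverge, in agreement with
  \<open>exp_enat c \<infinity> = \<infinity>\<close>.
\<close>

lemma exp_enat_dev_count_le:
  assumes c: "0 < c"
  shows "exp_enat c (dev_count X F e \<omega>)
    \<le> 1 + (\<Sum>n. indicator {n. e \<le> sup_dev X F (n + 1) \<omega>} n * ennreal (exp (c * real (n + 1))))"
proof -
  define S where "S = {n. 1 \<le> n \<and> sup_dev X F n \<omega> \<ge> e}"
  define f where "f n = indicator {n. e \<le> sup_dev X F (n + 1) \<omega>} n * ennreal (exp (c * real (n + 1)))" for n
  have count: "dev_count X F e \<omega> = (if finite S then enat (card S) else \<infinity>)"
    by (simp only: dev_count_def S_def)
  have term_le: "ennreal (exp (c * real n)) \<le> 1 + suminf f" if "n \<in> S" for n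
  proof -
    have "ennreal (exp (c * real n)) = f (n - 1)"
      using that by (auto simp: S_def f_def)
    also have "\<dots> = sum f {n - 1}" by simp
    also have "\<dots> \<le> suminf f" by (intro sum_le_suminf) auto
    also have "\<dots> \<le> 1 + suminf f" by simp
    finally show ?thesis .
  qed
  have exp_le: "ennreal (exp (c * real k)) \<le> 1 + suminf f" if "n \<in> S" "k \<le> n" for k n
  proof -
    have "ennreal (exp (c * real k)) \<le> ennreal (exp (c * real n))"
      using that c by (intro ennreal_leI) auto
    with term_le[OF that(1)] show ?thesis by (rule order_trans[rotated])
  qed
  have "exp_enat c (dev_count X F e \<omega>) \<le> 1 + suminf f"
  proof (cases "finite S")
    case True
    show ?thesis
    proof (cases "S = {}")
      case False
      have "S \<subseteq> {1..Max S}" using True by (auto simp: S_def)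
      then have "card S \<le> Max S" using card_mono[of "{1..Max S}" S] by simp
      then show ?thesis
        using exp_le[of "Max S" "card S"] True False
        by (simp add: exp_enat_def count)
    next
      case empty: True
      then show ?thesis
        by (simp add: exp_enat_def count)
    qed
  next
    case False
    have "1 + suminf f = top"
    proof (rule ccontr)
      assume "1 + suminf f \<noteq> top"
      then obtain y where y: "0 \<le> y" "1 + suminf f = ennreal y"
        by (cases "1 + suminf f") auto
      obtain k where "y < c * real k" using reals_Archimedean3[OF c] by (metis mult.commute)
      moreover obtain n where "n \<in> S" "k \<le> n"
        using False by (metis infinite_nat_iff_unbounded_le)
      ultimately have "exp (c * real k) \<le> y" "y < c * real k"
        using exp_le[of n k] y by auto
      then show False using exp_ge_add_one_self[of "c * real k"] by linarith
    qed
    then show ?thesis by simp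
  qed
  then show ?thesis by (simp only: f_def[abs_def])
qed

lemma dev_count_geD:
  assumes "enat k \<le> dev_count X F e \<omega>" "1 \<le> k"
  shows "\<exists>n\<ge>k. e \<le> sup_dev X F n \<omega>"
proof (cases "finite {n. 1 \<le> n \<and> sup_dev X F n \<omega> \<ge> e}")
  case True
  show ?thesis
  proof (rule ccontr)
    assume "\<not> ?thesis"
    then have "{n. 1 \<le> n \<and> sup_dev X F n \<omega> \<ge> e} \<subseteq> {1..<k}" by (auto simp: not_le[symmetric])
    then have "card {n. 1 \<le> n \<and> sup_dev X F n \<omega> \<ge> e} \<le> k - 1"
      using card_mono[of "{1..<k}"] by fastforce
    with True assms show False by (simp add: dev_count_def)
  qed
next
  case False
  then show ?thesis by (auto simp: infinite_nat_iff_unbounded_le)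
qed

section \<open>Deviation frequencies of the empirical distribution function\<close>

context iid_real_sequence
begin

lemma exceedance_events:
  assumes e: "0 < e" "e \<le> 1"
  obtains E where "\<And>n. E n \<in> events"
    "\<And>n \<omega>. 1 \<le> n \<Longrightarrow> \<omega> \<in> space M \<Longrightarrow> e \<le> sup_dev X (cdf D) n \<omega> \<Longrightarrow> \<omega> \<in> E n"
    "\<And>n. 1 \<le> n \<Longrightarrow> prob (E n) \<le> 192 * exp 4 / e ^ 4 * exp (- (2 * e\<^sup>2) * real n)"
proof -
  define P where "P n E \<longleftrightarrow> E \<in> events \<and> (1 \<le> n \<longrightarrow> {\<omega> \<in> space M. e \<le> sup_dev X (cdf D) n \<omega>} \<subseteq> E \<and>
      prob E \<le> 192 * exp 4 / e ^ 4 * exp (- 2 * real n * e\<^sup>2))" for n E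
  have "\<exists>E. P n E" for n
  proof (cases "1 \<le> n")
    case True
    then show ?thesis by (rule sup_dev_tail[OF _ e]) (auto simp: P_def)
  next
    case False
    then show ?thesis by (auto simp: P_def)
  qed
  then obtain E where E: "\<And>n. P n (E n)" by metis
  show ?thesis
  proof (rule that[of E])
    show "E n \<in> events" for n using E[of n] by (simp add: P_def)
    show "\<omega> \<in> E n" if "1 \<le> n" "\<omega> \<in> space M" "e \<le> sup_dev X (cdf D) n \<omega>" for n \<omega>
      using E[of n] that by (auto simp: P_def)
    show "prob (E n) \<le> 192 * exp 4 / e ^ 4 * exp (- (2 * e\<^sup>2) * real n)" if "1 \<le> n" for n
    proof -
      have "- (2 * e\<^sup>2) * real n = - 2 * real n * e\<^sup>2" by simp
      then show ?thesis using E[of n] that by (simp only: P_def)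
    qed
  qed
qed

text \<open>
  Deviation times start at \<open>1\<close>, so \<open>k\<close> of them force one at some \<open>n \<ge> k\<close>. Summing the tail bound over
  \<open>n \<ge> k\<close> costs the factor \<open>1 + 1 / (2 e\<^sup>2)\<close> of the geometric series, which turns \<open>e ^ 4\<close> into \<open>e ^ 6\<close>.
\<close>

lemma dev_count_tail:
  assumes e: "0 < e" "e \<le> 1" and k: "1 \<le> k"
  shows "prob {\<omega> \<in> space M. enat k \<le> dev_count X (cdf D) e \<omega>}
    \<le> 384 * exp 4 / e ^ 6 * exp (- 2 * e\<^sup>2 * real k)"
proof -
  define c where "c = 192 * exp 4 / e ^ 4"
  have c: "0 \<le> c" using e by (simp add: c_def)
  obtain E where E: "\<And>n. E n \<in> events"
    "\<And>n \<omega>. 1 \<le> n \<Longrightarrow> \<omega> \<in> space M \<Longrightarrow> e \<le> sup_dev X (cdf D) n \<omega> \<Longrightarrow> \<omega> \<in> E n"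
    "\<And>n. 1 \<le> n \<Longrightarrow> prob (E n) \<le> c * exp (- (2 * e\<^sup>2) * real n)"
    by (rule exceedance_events[OF e, folded c_def]) (rule that)
  have a: "0 < 2 * e\<^sup>2" using e by simp
  have bound: "prob (E (n + k)) \<le> c * exp (- (2 * e\<^sup>2) * real (n + k))" for n
    using E(3)[of "n + k"] k by simp
  have summable: "summable (\<lambda>n. c * exp (- (2 * e\<^sup>2) * real (n + k)))"
    by (intro summable_mult summable_exp_tail a)
  then have summable': "summable (\<lambda>n. prob (E (n + k)))"
    by (rule summable_comparison_test'[where N = 0]) (simp only: real_norm_def abs_of_nonneg[OF measure_nonneg] bound)
  have "prob {\<omega> \<in> space M. enat k \<le> dev_count X (cdf D) e \<omega>} \<le> prob (\<Union>n. E (n + k))"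
  proof (rule finite_measure_mono)
    show "{\<omega> \<in> space M. enat k \<le> dev_count X (cdf D) e \<omega>} \<subseteq> (\<Union>n. E (n + k))"
    proof
      fix \<omega> assume \<omega>: "\<omega> \<in> {\<omega> \<in> space M. enat k \<le> dev_count X (cdf D) e \<omega>}"
      then have "enat k \<le> dev_count X (cdf D) e \<omega>" by simp
      from dev_count_geD[OF this k] obtain n where n: "k \<le> n" "e \<le> sup_dev X (cdf D) n \<omega>"
        by blast
      then have "\<omega> \<in> E (n - k + k)" using E(2)[of n \<omega>] \<omega> k by auto
      then show "\<omega> \<in> (\<Union>n. E (n + k))" by (rule UN_I[OF UNIV_I])
    qed
  qed (use E(1) in auto)
  also have "\<dots> \<le> (\<Sum>n. prob (E (n + k)))"
    using E(1) summable' by (intro finite_measure_subadditive_countably) auto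
  also have "\<dots> \<le> (\<Sum>n. c * exp (- (2 * e\<^sup>2) * real (n + k)))"
    by (intro suminf_le bound summable summable')
  also have "\<dots> = c * (\<Sum>n. exp (- (2 * e\<^sup>2) * real (n + k)))"
    by (intro suminf_mult summable_exp_tail a)
  also have "\<dots> \<le> c * ((1 + 1 / (2 * e\<^sup>2)) * exp (- (2 * e\<^sup>2) * real k))"
    by (intro mult_left_mono suminf_exp_tail_le a c)
  also have "\<dots> \<le> c * (2 / e\<^sup>2 * exp (- (2 * e\<^sup>2) * real k))"
  proof (intro mult_left_mono mult_right_mono c)
    have "e\<^sup>2 \<le> 1" using e by (intro power_le_one) auto
    then have "1 \<le> 1 / e\<^sup>2" using e by simp
    moreover have "1 / (2 * e\<^sup>2) = 1 / 2 * (1 / e\<^sup>2)" "2 / e\<^sup>2 = 2 * (1 / e\<^sup>2)" by simp_all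
    ultimately show "1 + 1 / (2 * e\<^sup>2) \<le> 2 / e\<^sup>2" by linarith
  qed simp
  also have "\<dots> = 384 * exp 4 / e ^ 6 * exp (- 2 * e\<^sup>2 * real k)"
  proof -
    have "e ^ 6 = e ^ 4 * e\<^sup>2" by simp
    then show ?thesis by (simp only: c_def) simp
  qed
  finally show ?thesis .
qed

text \<open>
  Taking expectations in the pathwise bound for \<open>exp_enat\<close> combines the weight \<open>exp (2 \<eta>\<^sup>2 n)\<close> with the
  tail bound at time \<open>n\<close> to the term \<open>exp (-2 (e\<^sup>2 - \<eta>\<^sup>2) n)\<close> of a convergent geometric series.
\<close>

lemma dev_count_exp_moment:
  assumes e: "0 < e" "e \<le> 1" and eta: "0 < \<eta>" "\<eta> < e"
  shows "(\<integral>\<^sup>+\<omega>. exp_enat (2 * \<eta>\<^sup>2) (dev_count X (cdf D) e \<omega>) \<partial>M)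
    \<le> ennreal (1 + 192 * exp 4 / e ^ 4 / (2 * (e\<^sup>2 - \<eta>\<^sup>2)))"
proof -
  define c where "c = 192 * exp 4 / e ^ 4"
  have c: "0 \<le> c" using e by (simp add: c_def)
  obtain E where E: "\<And>n. E n \<in> events"
    "\<And>n \<omega>. 1 \<le> n \<Longrightarrow> \<omega> \<in> space M \<Longrightarrow> e \<le> sup_dev X (cdf D) n \<omega> \<Longrightarrow> \<omega> \<in> E n"
    "\<And>n. 1 \<le> n \<Longrightarrow> prob (E n) \<le> c * exp (- (2 * e\<^sup>2) * real n)"
    by (rule exceedance_events[OF e, folded c_def]) (rule that)
  note [measurable] = E(1)
  have a: "0 < 2 * (e\<^sup>2 - \<eta>\<^sup>2)" using eta by (simp add: power_strict_mono)
  let ?w = "\<lambda>n. exp (2 * \<eta>\<^sup>2 * real (n + 1))"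
  let ?u = "\<lambda>n. c * exp (- (2 * (e\<^sup>2 - \<eta>\<^sup>2)) * real (n + 1))"
  have summable: "summable ?u"
    by (intro summable_mult summable_exp_tail a)
  have "(\<integral>\<^sup>+\<omega>. exp_enat (2 * \<eta>\<^sup>2) (dev_count X (cdf D) e \<omega>) \<partial>M)
    \<le> (\<integral>\<^sup>+\<omega>. 1 + (\<Sum>n. indicator (E (n + 1)) \<omega> * ennreal (?w n)) \<partial>M)"
  proof (rule nn_integral_mono)
    fix \<omega> assume \<omega>: "\<omega> \<in> space M"
    have "exp_enat (2 * \<eta>\<^sup>2) (dev_count X (cdf D) e \<omega>)
      \<le> 1 + (\<Sum>n. indicator {n. e \<le> sup_dev X (cdf D) (n + 1) \<omega>} n * ennreal (?w n))"
      using eta by (intro exp_enat_dev_count_le) simp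
    also have "\<dots> \<le> 1 + (\<Sum>n. indicator (E (n + 1)) \<omega> * ennreal (?w n))"
      using E(2) \<omega> by (intro add_left_mono suminf_le mult_right_mono) (auto simp: indicator_def)
    finally show "exp_enat (2 * \<eta>\<^sup>2) (dev_count X (cdf D) e \<omega>)
      \<le> 1 + (\<Sum>n. indicator (E (n + 1)) \<omega> * ennreal (?w n))" .
  qed
  also have "\<dots> = 1 + (\<Sum>n. emeasure M (E (n + 1)) * ennreal (?w n))"
    by (simp add: nn_integral_add nn_integral_suminf nn_integral_multc emeasure_space_1)
  also have "\<dots> \<le> 1 + (\<Sum>n. ennreal (?u n))"
  proof (intro add_left_mono suminf_le)
    fix n
    have "prob (E (n + 1)) * ?w n \<le> c * exp (- (2 * e\<^sup>2) * real (n + 1)) * ?w n"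
      by (intro mult_right_mono E) auto
    also have "\<dots> = ?u n"
      by (simp add: exp_add[symmetric] algebra_simps)
    finally show "emeasure M (E (n + 1)) * ennreal (?w n) \<le> ennreal (?u n)"
      by (simp add: emeasure_eq_measure ennreal_mult[symmetric] ennreal_leI)
  qed auto
  also have "(\<Sum>n. ennreal (?u n)) = ennreal (suminf ?u)"
    using summable c by (intro suminf_ennreal2) auto
  also have "1 + ennreal (suminf ?u) = ennreal (1 + suminf ?u)"
    using suminf_nonneg[OF summable] c by (simp add: ennreal_plus del: of_nat_add)
  also have "\<dots> \<le> ennreal (1 + c * (1 / (2 * (e\<^sup>2 - \<eta>\<^sup>2))))"
  proof (intro ennreal_leI add_left_mono)
    have "suminf ?u = c * (\<Sum>n. exp (- (2 * (e\<^sup>2 - \<eta>\<^sup>2)) * real (n + 1)))"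
      by (intro suminf_mult summable_exp_tail a)
    also have "\<dots> \<le> c * (1 / (2 * (e\<^sup>2 - \<eta>\<^sup>2)))"
      by (intro mult_left_mono suminf_exp_from_1_le a c)
    finally show "suminf ?u \<le> c * (1 / (2 * (e\<^sup>2 - \<eta>\<^sup>2)))" .
  qed
  finally show ?thesis by (simp add: c_def)
qed

lemma bdd_above_deviation: "bdd_above (range (\<lambda>x. \<bar>emp_cdf X n x \<omega> - cdf D x\<bar>))"
  and deviation_le_1: "\<bar>emp_cdf X n x \<omega> - cdf D x\<bar> \<le> 1"
proof -
  have *: "\<bar>emp_cdf X n x \<omega> - cdf D x\<bar> \<le> 1" for x
    using freq_le_1[of n "{..x}" \<omega>] freq_nonneg[of n "{..x}" \<omega>] D.cdf_nonneg[of x] D.cdf_bounded_prob[of x]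
    unfolding emp_cdf_eq_freq by linarith
  then show "bdd_above (range (\<lambda>x. \<bar>emp_cdf X n x \<omega> - cdf D x\<bar>))" by (auto intro!: bdd_aboveI)
  show "\<bar>emp_cdf X n x \<omega> - cdf D x\<bar> \<le> 1" by (rule *)
qed

lemma sup_dev_nonneg: "0 \<le> sup_dev X (cdf D) n \<omega>"
  unfolding sup_dev_def by (rule order_trans[OF _ cSUP_upper[OF UNIV_I bdd_above_deviation]]) simp

lemma sup_dev_le_1: "sup_dev X (cdf D) n \<omega> \<le> 1"
  unfolding sup_dev_def by (intro cSUP_least deviation_le_1) auto

lemma dev_count_eq_0:
  assumes "1 < e"
  shows "dev_count X (cdf D) e \<omega> = 0"
proof -
  have "\<not> e \<le> sup_dev X (cdf D) n \<omega>" for n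
    using sup_dev_le_1[of n \<omega>] assms by linarith
  then show ?thesis by (simp add: dev_count_def zero_enat_def)
qed

lemma Glivenko_Cantelli: "AE \<omega> in M. (\<lambda>n. sup_dev X (cdf D) n \<omega>) \<longlonglongrightarrow> 0"
proof -
  have small: "AE \<omega> in M. \<forall>\<^sub>F n in sequentially. sup_dev X (cdf D) n \<omega> < e" if e: "0 < e" "e \<le> 1" for e
  proof -
    obtain E where E: "\<And>n. E n \<in> events"
      "\<And>n \<omega>. 1 \<le> n \<Longrightarrow> \<omega> \<in> space M \<Longrightarrow> e \<le> sup_dev X (cdf D) n \<omega> \<Longrightarrow> \<omega> \<in> E n"
      "\<And>n. 1 \<le> n \<Longrightarrow> prob (E n) \<le> 192 * exp 4 / e ^ 4 * exp (- (2 * e\<^sup>2) * real n)"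
      by (rule exceedance_events[OF e]) (rule that)
    have "summable (\<lambda>n. 192 * exp 4 / e ^ 4 * exp (- (2 * e\<^sup>2) * real n))"
      using summable_exp_tail[of "2 * e\<^sup>2" 0] e by (intro summable_mult) simp
    then have "summable (\<lambda>n. prob (E n))"
      by (rule summable_comparison_test'[where N = 1]) (simp only: real_norm_def abs_of_nonneg[OF measure_nonneg] E(3))
    then have "AE \<omega> in M. \<forall>\<^sub>F n in sequentially. \<omega> \<in> space M - E n"
      by (intro borel_cantelli_AE1 E(1)) (auto simp: emeasure_eq_measure)
    then show ?thesis
    proof eventually_elim
      case (elim \<omega>)
      from this eventually_ge_at_top[of 1] show ?case
      proof eventually_elim
        case (elim n)
        then show ?case using E(2)[of n \<omega>] by (meson DiffD1 DiffD2 not_le)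
      qed
    qed
  qed
  have "AE \<omega> in M. \<forall>j. \<forall>\<^sub>F n in sequentially. sup_dev X (cdf D) n \<omega> < 1 / real (Suc j)"
    unfolding AE_all_countable by (intro allI small) auto
  then show ?thesis
  proof eventually_elim
    case (elim \<omega>)
    show ?case
    proof (rule order_tendstoI)
      fix y :: real assume "y < 0"
      then show "\<forall>\<^sub>F n in sequentially. y < sup_dev X (cdf D) n \<omega>"
        by (intro always_eventually allI less_le_trans[OF _ sup_dev_nonneg])
    next
      fix y :: real assume "0 < y"
      then obtain j where "1 / real (Suc j) < y" using nat_approx_posE by metis
      with elim[rule_format, of j] show "\<forall>\<^sub>F n in sequentially. sup_dev X (cdf D) n \<omega> < y"
        by (auto elim!: eventually_mono)
    qed
  qed
qed

end

theorem theorem6: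
  fixes M :: "'a measure" and X :: "nat \<Rightarrow> 'a \<Rightarrow> real"
    and D :: "real measure" and F :: "real \<Rightarrow> real"
  assumes "prob_space M"
    and "prob_space.indep_vars M (\<lambda>_. borel) X {1..}"
    and "\<And>i. 1 \<le> i \<Longrightarrow> distr M borel (X i) = D"
    and "F = cdf D"
  shows "(\<forall>n\<ge>1. \<forall>x. integrable M (emp_cdf X n x) \<and> (\<integral>\<omega>. emp_cdf X n x \<omega> \<partial>M) = F x)
    \<and> (AE \<omega> in M. (\<lambda>n. sup_dev X F n \<omega>) \<longlonglongrightarrow> 0)
    \<and> (\<forall>B>0. \<exists>K>0. \<forall>\<epsilon>>0. \<forall>\<eta>. 0 < \<eta> \<and> \<eta> < \<epsilon> \<longrightarrow>
          (\<epsilon> \<le> B \<longrightarrow>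
            (\<integral>\<^sup>+\<omega>. exp_enat (2 * \<eta>\<^sup>2) (dev_count X F \<epsilon> \<omega>) \<partial>M)
              \<le> ennreal (K / (\<epsilon> ^ 6 * (\<epsilon> - \<eta>))))
          \<and> (\<forall>k\<ge>1. measure M {\<omega> \<in> space M. enat k \<le> dev_count X F \<epsilon> \<omega>}
              \<le> K / (\<epsilon> ^ 6 * (\<epsilon> - \<eta>)) * exp (- 2 * \<epsilon>\<^sup>2 * real k)))"
proof -
  interpret prob_space M by fact
  interpret iid_real_sequence M X D by unfold_locales (use assms in auto)
  have mean: "integrable M (emp_cdf X n x) \<and> (\<integral>\<omega>. emp_cdf X n x \<omega> \<partial>M) = F x" if "1 \<le> n" for n x
  proof -
    have "emp_cdf X n x = freq n {..x}" by (rule ext) (rule emp_cdf_eq_freq)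
    then show ?thesis using expectation_freq[OF that, of "{..x}"] \<open>F = cdf D\<close> by (simp add: cdf_def)
  qed
  have bounds: "\<exists>K>0. \<forall>\<epsilon>>0. \<forall>\<eta>. 0 < \<eta> \<and> \<eta> < \<epsilon> \<longrightarrow>
          (\<epsilon> \<le> B \<longrightarrow>
            (\<integral>\<^sup>+\<omega>. exp_enat (2 * \<eta>\<^sup>2) (dev_count X F \<epsilon> \<omega>) \<partial>M)
              \<le> ennreal (K / (\<epsilon> ^ 6 * (\<epsilon> - \<eta>))))
          \<and> (\<forall>k\<ge>1. measure M {\<omega> \<in> space M. enat k \<le> dev_count X F \<epsilon> \<omega>}
              \<le> K / (\<epsilon> ^ 6 * (\<epsilon> - \<eta>)) * exp (- 2 * \<epsilon>\<^sup>2 * real k))" if B: "0 < B" for B :: real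
  \<comment> \<open>The summand \<open>B ^ 7\<close> serves \<open>1 < \<epsilon> \<le> B\<close>, where the exponential moment equals \<open>1\<close>; the rest
    serves \<open>\<epsilon> \<le> 1\<close>.\<close>
  proof (intro exI[of _ "1 + 384 * exp 4 + B ^ 7"] conjI allI impI; (elim conjE)?)
    show "0 < 1 + 384 * exp 4 + B ^ 7" using B by (simp add: add_pos_pos)
  next
    fix \<epsilon> \<eta> :: real
    assume eps: "0 < \<epsilon>" "0 < \<eta>" "\<eta> < \<epsilon>" "\<epsilon> \<le> B"
    show "(\<integral>\<^sup>+\<omega>. exp_enat (2 * \<eta>\<^sup>2) (dev_count X F \<epsilon> \<omega>) \<partial>M)
              \<le> ennreal ((1 + 384 * exp 4 + B ^ 7) / (\<epsilon> ^ 6 * (\<epsilon> - \<eta>)))"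
    proof (cases "\<epsilon> \<le> 1")
      case True
      have pos: "0 < \<epsilon> ^ 6 * (\<epsilon> - \<eta>)" using eps by simp
      have "\<epsilon> ^ 6 * (\<epsilon> - \<eta>) \<le> 1 * 1"
        using True eps by (intro mult_mono power_le_one) auto
      then have one: "1 \<le> 1 / (\<epsilon> ^ 6 * (\<epsilon> - \<eta>))"
        using pos by (simp only: le_divide_eq_1_pos)
      have bpos: "0 \<le> B ^ 7 / (\<epsilon> ^ 6 * (\<epsilon> - \<eta>))" using B pos by simp
      have "\<epsilon>\<^sup>2 \<le> \<epsilon> + \<eta>"
        using mult_right_mono[OF True, of \<epsilon>] eps unfolding power2_eq_square by linarith
      then have "\<epsilon> ^ 4 * \<epsilon>\<^sup>2 * (\<epsilon> - \<eta>) \<le> \<epsilon> ^ 4 * (\<epsilon> + \<eta>) * (\<epsilon> - \<eta>)"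
        using eps by (intro mult_left_mono mult_right_mono) auto
      moreover have "\<epsilon>\<^sup>2 - \<eta>\<^sup>2 = (\<epsilon> + \<eta>) * (\<epsilon> - \<eta>)"
        by (simp add: power2_eq_square algebra_simps)
      ultimately have "\<epsilon> ^ 6 * (\<epsilon> - \<eta>) \<le> \<epsilon> ^ 4 * (\<epsilon>\<^sup>2 - \<eta>\<^sup>2)"
        by (simp add: mult.assoc)
      then have "96 * exp 4 / (\<epsilon> ^ 4 * (\<epsilon>\<^sup>2 - \<eta>\<^sup>2)) \<le> 384 * exp 4 / (\<epsilon> ^ 6 * (\<epsilon> - \<eta>))"
        using pos by (intro frac_le) simp_all
      moreover have "192 * exp 4 / \<epsilon> ^ 4 / (2 * (\<epsilon>\<^sup>2 - \<eta>\<^sup>2)) = 96 * exp 4 / (\<epsilon> ^ 4 * (\<epsilon>\<^sup>2 - \<eta>\<^sup>2))"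
        by (simp only: divide_divide_eq_left mult.left_commute[of _ 2] mult_2[of "_ * _"]) simp
      ultimately have "1 + 192 * exp 4 / \<epsilon> ^ 4 / (2 * (\<epsilon>\<^sup>2 - \<eta>\<^sup>2))
          \<le> 1 / (\<epsilon> ^ 6 * (\<epsilon> - \<eta>)) + 384 * exp 4 / (\<epsilon> ^ 6 * (\<epsilon> - \<eta>)) + B ^ 7 / (\<epsilon> ^ 6 * (\<epsilon> - \<eta>))"
        using one bpos by linarith
      then show ?thesis
        using dev_count_exp_moment[OF eps(1) True eps(2,3)] unfolding \<open>F = cdf D\<close> add_divide_distrib
        by (meson ennreal_leI order_trans)
    next
      case False
      have "\<epsilon> ^ 6 * (\<epsilon> - \<eta>) \<le> B ^ 6 * B"
        using eps by (intro mult_mono power_mono) auto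
      moreover have "B ^ 6 * B = B ^ 7" by (simp flip: power_Suc2)
      ultimately have "\<epsilon> ^ 6 * (\<epsilon> - \<eta>) \<le> 1 + 384 * exp 4 + B ^ 7"
        using exp_gt_zero[of "4::real"] by linarith
      moreover have "0 < \<epsilon> ^ 6 * (\<epsilon> - \<eta>)" using eps by simp
      ultimately have "1 \<le> (1 + 384 * exp 4 + B ^ 7) / (\<epsilon> ^ 6 * (\<epsilon> - \<eta>))"
        by (simp only: le_divide_eq_1_pos)
      then show ?thesis
        using False dev_count_eq_0[of \<epsilon>]
        by (simp add: \<open>F = cdf D\<close> exp_enat_def zero_enat_def emeasure_space_1)
    qed
  next
    fix \<epsilon> \<eta> :: real and k :: nat
    assume eps: "0 < \<epsilon>" "0 < \<eta>" "\<eta> < \<epsilon>" and k: "1 \<le> k"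
    show "measure M {\<omega> \<in> space M. enat k \<le> dev_count X F \<epsilon> \<omega>}
              \<le> (1 + 384 * exp 4 + B ^ 7) / (\<epsilon> ^ 6 * (\<epsilon> - \<eta>)) * exp (- 2 * \<epsilon>\<^sup>2 * real k)"
    proof (cases "\<epsilon> \<le> 1")
      case True
      have "measure M {\<omega> \<in> space M. enat k \<le> dev_count X F \<epsilon> \<omega>}
        \<le> 384 * exp 4 / \<epsilon> ^ 6 * exp (- 2 * \<epsilon>\<^sup>2 * real k)"
        unfolding \<open>F = cdf D\<close> by (rule dev_count_tail[OF eps(1) True k])
      also have "\<dots> \<le> (1 + 384 * exp 4 + B ^ 7) / (\<epsilon> ^ 6 * (\<epsilon> - \<eta>)) * exp (- 2 * \<epsilon>\<^sup>2 * real k)"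
      proof (intro mult_right_mono frac_le)
        show "\<epsilon> ^ 6 * (\<epsilon> - \<eta>) \<le> \<epsilon> ^ 6" using True eps by (intro mult_left_le) auto
      qed (use eps B in auto)
      finally show ?thesis .
    next
      case False
      have "\<not> enat k \<le> 0" using k by (simp add: zero_enat_def)
      then have "{\<omega> \<in> space M. enat k \<le> dev_count X F \<epsilon> \<omega>} = {}"
        using False dev_count_eq_0[of \<epsilon>] \<open>F = cdf D\<close> by auto
      then have "measure M {\<omega> \<in> space M. enat k \<le> dev_count X F \<epsilon> \<omega>} = 0" by (simp only: measure_empty)
      then show ?thesis using eps B by simp
    qed
  qed
  show ?thesis
  proof (intro conjI)
    show "\<forall>n\<ge>1. \<forall>x. integrable M (emp_cdf X n x) \<and> (\<integral>\<omega>. emp_cdf X n x \<omega> \<partial>M) = F x"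
      using mean by simp
    show "AE \<omega> in M. (\<lambda>n. sup_dev X F n \<omega>) \<longlonglongrightarrow> 0"
      unfolding \<open>F = cdf D\<close> by (rule Glivenko_Cantelli)
  qed (intro allI impI bounds)
qed

end
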